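(* Let $(\leq_A)_{A \subseteq S}$ be a family of binary relations on acts satisfying postulates (Q1)--(Q6), and let $\leq$ be the relation on events defined by it. Let $A, B, D \subseteq S$ with $A \cap D = B \cap D = \emptyset$. If $A \leq B$, then $A \cup D \leq B \cup D$.
   Context: $S$ is a non-empty set of states, $F$ a set of consequences; events are arbitrary subsets of $S$; acts are arbitrary functions $S \to F$. For each event $A$ a binary relation $\leq_A$ on acts is given. Write $f \sim_A g$ for ($f \leq_A g$ and $g \leq_A f$), $f <_A g$ for ($f \leq_A g$ and not $g \leq_A f$), and $f =_A g$ if $f(s)=g(s)$ for all $s \in A$. An event $A$ is null if $h \leq_A h'$ for all acts $h,h'$. For disjoint $A,B$, write $A \,\mathcal{N}\, B$ if for all acts $h,h'$: $h \leq_{A\cup B} h' \Leftrightarrow h \leq_B h'$. A consequence $c\in F$ is identified with the constant act with value $c$. For consequences, $c \leq d$ (without subscript) means $c \leq_B d$ for every event $B$ (under (Q5), if some event is non-null, this is equivalent to $c \leq_A d$ for one, equivalently every, non-null $A$), and $d < c$ means $d \leq c$ and not $c \leq d$. $w_A^{c,d}$ is the act with value $c$ on $A$ and $d$ on $S \setminus A$. Postulates (for all acts $f,g,h$ and events $A,B$): (Q1) $f \leq_A g$ and $g \leq_A h$ imply $f \leq_A h$. (Q2) $f =_A g$ implies $f \sim_A g$. (Q3) if $A \cap B = \emptyset$, $f \leq_A g$ and $f \sim_B g$, then $f \leq_{A \cup B} g$. (Q4) if $A \cap B = \emptyset$, $f \leq_{A\cup B} g$ and $f \sim_B g$, then either $f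 \leq_A g$ or $A \,\mathcal{N}\, B$. (Q5) if $c,d$ are constant acts, $A$ is not null and $c \leq_A d$, then $c \leq_B d$ for every event $B$. (Q6) there are consequences $c,d$ with $d < c$. Relation on events defined by the family: for events $A,B$, $A \leq B$ iff for all consequences $c,d$ with $d < c$, $w_A^{c,d} \leq_{A\cup B} w_B^{c,d}$. *)

theory Defs
  imports Main
begin

text \<open>
  The set of states is the (non-empty) type \<open>'s\<close>, the set of consequences the type \<open>'f\<close>;
  an event is any \<open>'s set\<close> and an act any function \<open>'s \<Rightarrow> 'f\<close>.
  For a family \<open>R\<close>, the formula \<open>R A f g\<close> stands for \<open>f \<le>\<^sub>A g\<close>.
\<close>

type_synonym ('s, 'f) act = "'s \<Rightarrow> 'f"

type_synonym ('s, 'f) pref_family = "'s set \<Rightarrow> ('s, 'f) act \<Rightarrow> ('s, 'f) act \<Rightarrow> bool"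

definition indiff :: "('s, 'f) pref_family \<Rightarrow> 's set \<Rightarrow> ('s, 'f) act \<Rightarrow> ('s, 'f) act \<Rightarrow> bool" where
  "indiff R A f g \<longleftrightarrow> R A f g \<and> R A g f"

definition agree_on :: "'s set \<Rightarrow> ('s, 'f) act \<Rightarrow> ('s, 'f) act \<Rightarrow> bool" where
  "agree_on A f g \<longleftrightarrow> (\<forall>s\<in>A. f s = g s)"

definition null_event :: "('s, 'f) pref_family \<Rightarrow> 's set \<Rightarrow> bool" where
  "null_event R A \<longleftrightarrow> (\<forall>h h'. R A h h')"

text \<open>The relation \<open>A N B\<close>, only meaningful for (and only used with) disjoint \<open>A\<close>, \<open>B\<close>.\<close>

definition negligible :: "('s, 'f) pref_family \<Rightarrow> 's set \<Rightarrow> 's set \<Rightarrow> bool" where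
  "negligible R A B \<longleftrightarrow> (\<forall>h h'. R (A \<union> B) h h' \<longleftrightarrow> R B h h')"

definition const_act :: "'f \<Rightarrow> ('s, 'f) act" where
  "const_act c = (\<lambda>s. c)"

definition cons_le :: "('s, 'f) pref_family \<Rightarrow> 'f \<Rightarrow> 'f \<Rightarrow> bool" where
  "cons_le R c d \<longleftrightarrow> (\<forall>B. R B (const_act c) (const_act d))"

definition cons_less :: "('s, 'f) pref_family \<Rightarrow> 'f \<Rightarrow> 'f \<Rightarrow> bool" where
  "cons_less R d c \<longleftrightarrow> cons_le R d c \<and> \<not> cons_le R c d"

definition bet :: "'s set \<Rightarrow> 'f \<Rightarrow> 'f \<Rightarrow> ('s, 'f) act" where
  "bet A c d = (\<lambda>s. if s \<in> A then c else d)"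

locale preference_postulates =
  fixes R :: "('s, 'f) pref_family"
  assumes Q1: "R A f g \<Longrightarrow> R A g h \<Longrightarrow> R A f h"
    and Q2: "agree_on A f g \<Longrightarrow> indiff R A f g"
    and Q3: "A \<inter> B = {} \<Longrightarrow> R A f g \<Longrightarrow> indiff R B f g \<Longrightarrow> R (A \<union> B) f g"
    and Q4: "A \<inter> B = {} \<Longrightarrow> R (A \<union> B) f g \<Longrightarrow> indiff R B f g \<Longrightarrow> R A f g \<or> negligible R A B"
    and Q5: "\<not> null_event R A \<Longrightarrow> R A (const_act c) (const_act d)
              \<Longrightarrow> R B (const_act c) (const_act d)"
    and Q6: "\<exists>c d. cons_less R d c"

definition event_le :: "('s, 'f) pref_family \<Rightarrow> 's set \<Rightarrow> 's set \<Rightarrow> bool" where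
  "event_le R A B \<longleftrightarrow> (\<forall>c d. cons_less R d c \<longrightarrow> R (A \<union> B) (bet A c d) (bet B c d))"

end

theory Submission
  imports Defs
begin

text \<open>Adding \<open>D\<close> to both events changes the two bets only on \<open>D\<close>,
  where both then pay the better consequence. So on \<open>A \<union> B\<close> the old comparison
  survives by \<open>Q2\<close> and \<open>Q1\<close>, on \<open>D\<close> the bets are indifferent,
  and \<open>Q3\<close> glues these two disjoint pieces into the union of the enlarged
  events.\<close>

theorem lemma9:
  fixes R :: "('s, 'f) pref_family"
    and A B D :: "'s set"
  assumes "preference_postulates R"
    and "A \<inter> D = {}"
    and "B \<inter> D = {}"
    and "event_le R A B"
  shows "event_le R (A \<union> D) (B \<union> D)"
proof -
  interpret preference_postulates R by fact
  have "R ((A \<union> D) \<union> (B \<union> D)) (bet (A \<union> D) c d) (bet (B \<union> D) c d)" (is "R _ ?f ?g")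
    if less: "cons_less R d c" for c d
  proof -
    have disj: "(A \<union> B) \<inter> D = {}"
      using assms(2,3) by blast
    \<comment> \<open>Since \<open>D\<close> misses \<open>A \<union> B\<close>, enlarging the
      winning event by \<open>D\<close> is invisible there.\<close>
    have "agree_on (A \<union> B) ?f (bet A c d)" and "agree_on (A \<union> B) (bet B c d) ?g"
      using disj by (auto simp: agree_on_def bet_def)
    then have "R (A \<union> B) ?f (bet A c d)" and "R (A \<union> B) (bet B c d) ?g"
      using Q2 by (auto simp: indiff_def)
    moreover have "R (A \<union> B) (bet A c d) (bet B c d)"
      using assms(4) less by (simp add: event_le_def)
    ultimately have "R (A \<union> B) ?f ?g"
      using Q1 by blast
    \<comment> \<open>Both bets are constantly \<open>c\<close> on \<open>D\<close>.\<close>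
    moreover have "indiff R D ?f ?g"
      by (rule Q2) (simp add: agree_on_def bet_def)
    ultimately have "R ((A \<union> B) \<union> D) ?f ?g"
      using disj Q3 by blast
    moreover have "(A \<union> D) \<union> (B \<union> D) = (A \<union> B) \<union> D"
      by blast
    ultimately show ?thesis
      by simp
  qed
  then show ?thesis
    by (simp add: event_le_def)
qed

end
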